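(* Consider the descriptor system $$A_nx(n+2)+B_nx(n+1)+C_nx(n)+D_nu(n)=f(n)\quad\text{for all } n\ge n_0,$$ with $A_n,B_n,C_n\in\mathbb R^{m,d}$, $D_n\in\mathbb R^{m,p}$, $f(n)\in\mathbb R^m$. Assume that its shift-index $\nu$ is well-defined, and that there exists a first order feedback $u(n)=F_{n,1}x(n+1)+F_{n,0}x(n)$ such that the corresponding initial value problem of the closed-loop system is uniquely solvable (see context). Then there is a system of the form $$\begin{bmatrix} \hat A_{n,1} & \hat B_{n,1} & \hat C_{n,1} \\ 0 & \hat B_{n,2} & \hat C_{n,2} \\ 0 & 0 & \hat C_{n,3} \\ 0 & \hat B_{n,5} & \hat C_{n,5} \\ 0 & 0 & \hat C_{n,6} \end{bmatrix} \begin{bmatrix} x(n+2) \\ x(n+1) \\ x(n) \end{bmatrix} + \begin{bmatrix} \hat D_{n,1} \\ 0 \\ 0 \\ \hat D_{n,4} \\ \hat D_{n,5} \end{bmatrix} u(n) = \begin{bmatrix} \hat G_{n,1} \\ \hat G_{n,2} \\ \hat G_{n,3} \\ \hat G_{n,4} \\ \hat G_{n,5} \end{bmatrix} \quad\text{for all } n\ge n_0,$$ with block rows of sizes $\hat r_2,\hat r_1,\hat r_0,\hat\varphi_1,\hat\varphi_0$, such that any solution to the descriptor system is also a solution to this system, where the matrices $\begin{bmatrix}\hat A_{n,1}^T&\hat B_{n+1,2}^T&\hat C_{n+2,3}^T\end{bmatrix}^T$ and $\begin{bmatrix}\hat D_{n,4}^T&\hat D_{n,5}^T\end{bmatrix}^T$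 have full row rank for all $n\ge n_0$. Furthermore, $\hat r_2+\hat r_1+\hat r_0+\hat\varphi_1+\hat\varphi_0=d$, or equivalently, $$\operatorname{rank}\begin{bmatrix} \hat A_{n,1} \\ \hat B_{n+1,2} \\ \hat C_{n+2,3} \end{bmatrix}+\operatorname{rank}\begin{bmatrix} \hat D_{n,4} \\ \hat D_{n,5} \end{bmatrix}=d.$$
   Context: **Unique solvability of the closed-loop system.** With $F_{n,1},F_{n,0}\in\mathbb R^{p,d}$, the closed-loop system is $A_nx(n+2)+(B_n+D_nF_{n,1})x(n+1)+(C_n+D_nF_{n,0})x(n)=f(n)$, $n\ge n_0$, with initial conditions $x(n_0+1)=x_1$, $x(n_0)=x_0$. Initial values $(x_0,x_1)$ are consistent if the initial value problem has at least one solution. "Uniquely solvable" means that consistent initial values exist and that for each consistent $(x_0,x_1)$ there is exactly one solution. **Difference-inflated system.** The difference-inflated system of level $\ell\in\{0,1,2,\dots\}$ at time $n$ is the collection of the equations $$A_{n+j}x(n+j+2)+B_{n+j}x(n+j+1)+C_{n+j}x(n+j)+D_{n+j}u(n+j)=f(n+j),\quad j=0,\dots,\ell,$$ regarded as one linear system in the unknowns $x(n),\dots,x(n+\ell+2)$, $u(n),\dots,u(n+\ell)$. **Strangeness-free descriptor system.** A system $$\begin{bmatrix} \hat A_{n,1} & \hat B_{n,1} & \hat C_{n,1} \\ 0 & \hat B_{n,2} & \hat C_{n,2} \\ 0 & 0 & \hat C_{n,3} \\ 0 & \hat B_{n,5} & \hat C_{n,5} \\ 0 & 0 & \hat C_{n,6}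 \\ 0 & 0 & 0 \end{bmatrix} \begin{bmatrix} x(n+2) \\ x(n+1) \\ x(n) \end{bmatrix} + \begin{bmatrix} \hat D_{n,1} \\ 0 \\ 0 \\ \hat D_{n,4} \\ \hat D_{n,5} \\ 0 \end{bmatrix} u(n)=\hat f(n),\quad n\ge n_0,$$ with block row sizes $\hat r_2,\hat r_1,\hat r_0,\hat\varphi_1,\hat\varphi_0,\hat v$ independent of $n$, such that $\begin{bmatrix}\hat A_{n,1}^T&\hat B_{n+1,2}^T&\hat C_{n+2,3}^T\end{bmatrix}^T$ and $\begin{bmatrix}\hat D_{n,4}^T&\hat D_{n,5}^T\end{bmatrix}^T$ have full row rank for all $n\ge n_0$, and which has, for each fixed input sequence $\{u(n)\}$, the same solution set as the given descriptor system. **Shift-index.** Let $\ell$ be the minimum number such that a strangeness-free descriptor system can be extracted from the difference-inflated systems of level $\ell$ by elementary matrix-row operations (i.e. for every $n\ge n_0$, its equations at time $n$ are linear combinations of the equations of the difference-inflated system of level $\ell$ at time $n$). The shift-index is $\nu=\ell/2$ if $\ell$ is even and $\nu=(\ell+1)/2$ if $\ell$ is odd; it is well-defined if such an $\ell$ exists. *)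

theory Defs
  imports Jordan_Normal_Form.Matrix Jordan_Normal_Form.DL_Rank
begin

text \<open>
  Time is integer-valued; coefficients, inputs and states are functions on all of \<open>int\<close>, and
  only their values at times \<open>n \<ge> n0\<close> matter.
\<close>

definition descriptor_solution ::
    "int \<Rightarrow> nat \<Rightarrow> nat \<Rightarrow> (int \<Rightarrow> real mat) \<Rightarrow> (int \<Rightarrow> real mat) \<Rightarrow> (int \<Rightarrow> real mat) \<Rightarrow>
     (int \<Rightarrow> real mat) \<Rightarrow> (int \<Rightarrow> real vec) \<Rightarrow> (int \<Rightarrow> real vec) \<Rightarrow> (int \<Rightarrow> real vec) \<Rightarrow> bool" where
  "descriptor_solution n0 d p A B C D f x u \<longleftrightarrow>
     (\<forall>n\<ge>n0. x n \<in> carrier_vec d \<and> u n \<in> carrier_vec p \<and>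
        A n *\<^sub>v x (n + 2) + B n *\<^sub>v x (n + 1) + C n *\<^sub>v x n + D n *\<^sub>v u n = f n)"


subsection \<open>Unique solvability of the closed-loop system\<close>

definition closed_loop_ivp_solution ::
    "int \<Rightarrow> nat \<Rightarrow> (int \<Rightarrow> real mat) \<Rightarrow> (int \<Rightarrow> real mat) \<Rightarrow> (int \<Rightarrow> real mat) \<Rightarrow>
     (int \<Rightarrow> real mat) \<Rightarrow> (int \<Rightarrow> real vec) \<Rightarrow> (int \<Rightarrow> real mat) \<Rightarrow> (int \<Rightarrow> real mat) \<Rightarrow>
     real vec \<Rightarrow> real vec \<Rightarrow> (int \<Rightarrow> real vec) \<Rightarrow> bool" where
  "closed_loop_ivp_solution n0 d A B C D f F1 F0 x0 x1 x \<longleftrightarrow>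
     (\<forall>n\<ge>n0. x n \<in> carrier_vec d \<and>
        A n *\<^sub>v x (n + 2) + (B n + D n * F1 n) *\<^sub>v x (n + 1) + (C n + D n * F0 n) *\<^sub>v x n = f n) \<and>
     x (n0 + 1) = x1 \<and> x n0 = x0"

definition consistent_initial_values ::
    "int \<Rightarrow> nat \<Rightarrow> (int \<Rightarrow> real mat) \<Rightarrow> (int \<Rightarrow> real mat) \<Rightarrow> (int \<Rightarrow> real mat) \<Rightarrow>
     (int \<Rightarrow> real mat) \<Rightarrow> (int \<Rightarrow> real vec) \<Rightarrow> (int \<Rightarrow> real mat) \<Rightarrow> (int \<Rightarrow> real mat) \<Rightarrow>
     real vec \<Rightarrow> real vec \<Rightarrow> bool" where
  "consistent_initial_values n0 d A B C D f F1 F0 x0 x1 \<longleftrightarrow>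
     (\<exists>x. closed_loop_ivp_solution n0 d A B C D f F1 F0 x0 x1 x)"

text \<open>Two solutions count as equal when they agree at all times \<open>n \<ge> n0\<close>.\<close>

definition closed_loop_uniquely_solvable ::
    "int \<Rightarrow> nat \<Rightarrow> (int \<Rightarrow> real mat) \<Rightarrow> (int \<Rightarrow> real mat) \<Rightarrow> (int \<Rightarrow> real mat) \<Rightarrow>
     (int \<Rightarrow> real mat) \<Rightarrow> (int \<Rightarrow> real vec) \<Rightarrow> (int \<Rightarrow> real mat) \<Rightarrow> (int \<Rightarrow> real mat) \<Rightarrow> bool" where
  "closed_loop_uniquely_solvable n0 d A B C D f F1 F0 \<longleftrightarrow>
     (\<exists>x0 x1. consistent_initial_values n0 d A B C D f F1 F0 x0 x1) \<and>
     (\<forall>x0 x1. consistent_initial_values n0 d A B C D f F1 F0 x0 x1 \<longrightarrow>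
        (\<exists>x. closed_loop_ivp_solution n0 d A B C D f F1 F0 x0 x1 x \<and>
             (\<forall>y. closed_loop_ivp_solution n0 d A B C D f F1 F0 x0 x1 y \<longrightarrow> (\<forall>n\<ge>n0. y n = x n))))"


subsection \<open>Systems in block form\<close>

definition full_row_rank :: "real mat \<Rightarrow> bool" where
  "full_row_rank M \<longleftrightarrow> vec_space.rank (dim_row M) M = dim_row M"

text \<open>The block row sizes are numbers and not functions of time; each of them may be zero.\<close>

record block_system =
  hr2 :: nat
  hr1 :: nat
  hr0 :: nat
  hphi1 :: nat
  hphi0 :: nat
  hA1 :: "int \<Rightarrow> real mat"
  hB1 :: "int \<Rightarrow> real mat"
  hC1 :: "int \<Rightarrow> real mat"
  hD1 :: "int \<Rightarrow> real mat"
  hB2 :: "int \<Rightarrow> real mat"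
  hC2 :: "int \<Rightarrow> real mat"
  hC3 :: "int \<Rightarrow> real mat"
  hB5 :: "int \<Rightarrow> real mat"
  hC5 :: "int \<Rightarrow> real mat"
  hD4 :: "int \<Rightarrow> real mat"
  hC6 :: "int \<Rightarrow> real mat"
  hD5 :: "int \<Rightarrow> real mat"

definition block_system_dims :: "int \<Rightarrow> nat \<Rightarrow> nat \<Rightarrow> block_system \<Rightarrow> bool" where
  "block_system_dims n0 d p H \<longleftrightarrow> (\<forall>n\<ge>n0.
     hA1 H n \<in> carrier_mat (hr2 H) d \<and> hB1 H n \<in> carrier_mat (hr2 H) d \<and>
     hC1 H n \<in> carrier_mat (hr2 H) d \<and> hD1 H n \<in> carrier_mat (hr2 H) p \<and>
     hB2 H n \<in> carrier_mat (hr1 H) d \<and> hC2 H n \<in> carrier_mat (hr1 H) d \<and>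
     hC3 H n \<in> carrier_mat (hr0 H) d \<and>
     hB5 H n \<in> carrier_mat (hphi1 H) d \<and> hC5 H n \<in> carrier_mat (hphi1 H) d \<and>
     hD4 H n \<in> carrier_mat (hphi1 H) p \<and>
     hC6 H n \<in> carrier_mat (hphi0 H) d \<and> hD5 H n \<in> carrier_mat (hphi0 H) p)"

definition state_rank_matrix :: "block_system \<Rightarrow> int \<Rightarrow> real mat" where
  "state_rank_matrix H n = hA1 H n @\<^sub>r hB2 H (n + 1) @\<^sub>r hC3 H (n + 2)"

definition input_rank_matrix :: "block_system \<Rightarrow> int \<Rightarrow> real mat" where
  "input_rank_matrix H n = hD4 H n @\<^sub>r hD5 H n"

definition block_system_full_rank :: "int \<Rightarrow> block_system \<Rightarrow> bool" where
  "block_system_full_rank n0 H \<longleftrightarrow>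
     (\<forall>n\<ge>n0. full_row_rank (state_rank_matrix H n) \<and> full_row_rank (input_rank_matrix H n))"

definition block_rows :: "block_system \<Rightarrow> nat" where
  "block_rows H = hr2 H + hr1 H + hr0 H + hphi1 H + hphi0 H"

text \<open>The coefficient matrices of \<open>x(n+2)\<close>, \<open>x(n+1)\<close>, \<open>x(n)\<close> and \<open>u(n)\<close>.\<close>

definition block_A :: "nat \<Rightarrow> block_system \<Rightarrow> int \<Rightarrow> real mat" where
  "block_A d H n =
     hA1 H n @\<^sub>r 0\<^sub>m (hr1 H) d @\<^sub>r 0\<^sub>m (hr0 H) d @\<^sub>r 0\<^sub>m (hphi1 H) d @\<^sub>r 0\<^sub>m (hphi0 H) d"

definition block_B :: "nat \<Rightarrow> block_system \<Rightarrow> int \<Rightarrow> real mat" where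
  "block_B d H n =
     hB1 H n @\<^sub>r hB2 H n @\<^sub>r 0\<^sub>m (hr0 H) d @\<^sub>r hB5 H n @\<^sub>r 0\<^sub>m (hphi0 H) d"

definition block_C :: "block_system \<Rightarrow> int \<Rightarrow> real mat" where
  "block_C H n =
     hC1 H n @\<^sub>r hC2 H n @\<^sub>r hC3 H n @\<^sub>r hC5 H n @\<^sub>r hC6 H n"

definition block_D :: "nat \<Rightarrow> block_system \<Rightarrow> int \<Rightarrow> real mat" where
  "block_D p H n =
     hD1 H n @\<^sub>r 0\<^sub>m (hr1 H) p @\<^sub>r 0\<^sub>m (hr0 H) p @\<^sub>r hD4 H n @\<^sub>r hD5 H n"


subsection \<open>Difference-inflated systems and the shift-index\<close>

text \<open>\<open>a \<times> b\<close> array of blocks \<open>M j k\<close>, each of size \<open>nr \<times> nc\<close>.\<close>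

definition block_matrix :: "nat \<Rightarrow> nat \<Rightarrow> nat \<Rightarrow> nat \<Rightarrow> (nat \<Rightarrow> nat \<Rightarrow> real mat) \<Rightarrow> real mat" where
  "block_matrix a b nr nc M =
     mat (a * nr) (b * nc) (\<lambda>(i, c). M (i div nr) (c div nc) $$ (i mod nr, c mod nc))"

text \<open>
  The inflated system of level \<open>l\<close> at time \<open>n\<close> reads
  \<open>inflated_state * X + inflated_input * U = inflated_rhs\<close>, where \<open>X\<close> stacks
  \<open>x(n), \<dots>, x(n+l+2)\<close> and \<open>U\<close> stacks \<open>u(n), \<dots>, u(n+l)\<close>.
\<close>

definition inflated_state ::
    "nat \<Rightarrow> nat \<Rightarrow> (int \<Rightarrow> real mat) \<Rightarrow> (int \<Rightarrow> real mat) \<Rightarrow> (int \<Rightarrow> real mat) \<Rightarrow> nat \<Rightarrow> int \<Rightarrow> real mat" where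
  "inflated_state m d A B C l n = block_matrix (l + 1) (l + 3) m d
     (\<lambda>j k. if k = j + 2 then A (n + int j)
            else if k = j + 1 then B (n + int j)
            else if k = j then C (n + int j)
            else 0\<^sub>m m d)"

definition inflated_input :: "nat \<Rightarrow> nat \<Rightarrow> (int \<Rightarrow> real mat) \<Rightarrow> nat \<Rightarrow> int \<Rightarrow> real mat" where
  "inflated_input m p D l n = block_matrix (l + 1) (l + 1) m p
     (\<lambda>j k. if k = j then D (n + int j) else 0\<^sub>m m p)"

definition inflated_rhs :: "nat \<Rightarrow> (int \<Rightarrow> real vec) \<Rightarrow> nat \<Rightarrow> int \<Rightarrow> real vec" where
  "inflated_rhs m f l n = vec ((l + 1) * m) (\<lambda>i. f (n + int (i div m)) $ (i mod m))"

text \<open>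
  The equations \<open>hA x(n+2) + hB x(n+1) + hC x(n) + hD u(n) = hf\<close> of a system with \<open>s\<close> rows,
  read as equations in the unknowns of the inflated system, arise from the latter by
  multiplication from the left with \<open>P\<close>.
\<close>

definition extracted_at ::
    "nat \<Rightarrow> nat \<Rightarrow> nat \<Rightarrow> (int \<Rightarrow> real mat) \<Rightarrow> (int \<Rightarrow> real mat) \<Rightarrow> (int \<Rightarrow> real mat) \<Rightarrow>
     (int \<Rightarrow> real mat) \<Rightarrow> (int \<Rightarrow> real vec) \<Rightarrow> nat \<Rightarrow> int \<Rightarrow>
     nat \<Rightarrow> real mat \<Rightarrow> real mat \<Rightarrow> real mat \<Rightarrow> real mat \<Rightarrow> real vec \<Rightarrow> bool" where
  "extracted_at m d p A B C D f l n s hA hB hC hD hf \<longleftrightarrow>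
     (\<exists>P \<in> carrier_mat s ((l + 1) * m).
        P * inflated_state m d A B C l n = block_matrix 1 (l + 3) s d
          (\<lambda>_ k. if k = 2 then hA else if k = 1 then hB else if k = 0 then hC else 0\<^sub>m s d) \<and>
        P * inflated_input m p D l n = block_matrix 1 (l + 1) s p
          (\<lambda>_ k. if k = 0 then hD else 0\<^sub>m s p) \<and>
        P *\<^sub>v inflated_rhs m f l n = hf)"

text \<open>
  Existence of a strangeness-free system, given by \<open>H\<close>, a last block row of \<open>v\<close> zero rows and
  the right-hand side \<open>hf\<close>, that can be extracted from the inflated systems of level \<open>l\<close>.
\<close>

definition strangeness_free_extractable ::
    "int \<Rightarrow> nat \<Rightarrow> nat \<Rightarrow> nat \<Rightarrow> (int \<Rightarrow> real mat) \<Rightarrow> (int \<Rightarrow> real mat) \<Rightarrow> (int \<Rightarrow> real mat) \<Rightarrow>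
     (int \<Rightarrow> real mat) \<Rightarrow> (int \<Rightarrow> real vec) \<Rightarrow> nat \<Rightarrow> bool" where
  "strangeness_free_extractable n0 m d p A B C D f l \<longleftrightarrow>
     (\<exists>H v hf.
        let hA = (\<lambda>n. block_A d H n @\<^sub>r 0\<^sub>m v d);
            hB = (\<lambda>n. block_B d H n @\<^sub>r 0\<^sub>m v d);
            hC = (\<lambda>n. block_C H n @\<^sub>r 0\<^sub>m v d);
            hD = (\<lambda>n. block_D p H n @\<^sub>r 0\<^sub>m v p)
        in block_system_dims n0 d p H \<and>
           (\<forall>n\<ge>n0. hf n \<in> carrier_vec (block_rows H + v)) \<and>
           block_system_full_rank n0 H \<and>
           (\<forall>u. (\<forall>n\<ge>n0. u n \<in> carrier_vec p) \<longrightarrow>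
              {x. descriptor_solution n0 d p hA hB hC hD hf x u} =
              {x. descriptor_solution n0 d p A B C D f x u}) \<and>
           (\<forall>n\<ge>n0. extracted_at m d p A B C D f l n
              (block_rows H + v) (hA n) (hB n) (hC n) (hD n) (hf n)))"

text \<open>
  A relation, since the shift-index need not exist: it is well-defined iff some \<open>\<nu>\<close> is related
  to the system, and then \<open>\<nu>\<close> is unique.
\<close>

definition has_shift_index ::
    "int \<Rightarrow> nat \<Rightarrow> nat \<Rightarrow> nat \<Rightarrow> (int \<Rightarrow> real mat) \<Rightarrow> (int \<Rightarrow> real mat) \<Rightarrow> (int \<Rightarrow> real mat) \<Rightarrow>
     (int \<Rightarrow> real mat) \<Rightarrow> (int \<Rightarrow> real vec) \<Rightarrow> nat \<Rightarrow> bool" where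
  "has_shift_index n0 m d p A B C D f \<nu> \<longleftrightarrow>
     (\<exists>l. strangeness_free_extractable n0 m d p A B C D f l \<and>
          (\<forall>l'<l. \<not> strangeness_free_extractable n0 m d p A B C D f l') \<and>
          \<nu> = (if even l then l div 2 else (l + 1) div 2))"

end

theory Submission
  imports Defs
begin

text \<open>
  The extracted strangeness-free system has at least \<open>d\<close> nonzero block rows. Suppose it has
  \<open>s < d\<close>. A sequence supported on \<open>T\<close> consecutive times has \<open>T * d\<close> free entries and meets only
  \<open>(T + 2) * s\<close> homogeneous closed-loop equations, so for large \<open>T\<close> some nonzero sequence with
  vanishing initial values satisfies all of them; adding it to a solution contradicts uniqueness.
  By full row rank at most \<open>d\<close> of the rows are state rows. Only an inclusion of solution sets is
  claimed, so surplus input rows may be dropped until exactly \<open>d\<close> rows remain, and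
  dropping rows preserves full row rank.
\<close>

section \<open>Linear algebra: full row rank and underdetermined systems\<close>

text \<open>The span of the columns is the image of \<open>M\<close>, so its dimension is
  \<open>nr\<close> exactly when the image is the whole space. In this form full row rank is easy to
  pass to a subset of the rows.\<close>

lemma full_row_rank_iff_surj:
  assumes M: "M \<in> carrier_mat nr nc"
  shows "full_row_rank M \<longleftrightarrow> (\<forall>b\<in>carrier_vec nr. \<exists>x\<in>carrier_vec nc. M *\<^sub>v x = b)"
proof -
  interpret vec_space "TYPE(real)" nr .
  have cols: "set (cols M) \<subseteq> carrier_vec nr" using cols_dim M by blast
  have span: "span (set (cols M)) = {b \<in> carrier_vec nr. \<exists>x\<in>carrier_vec nc. M *\<^sub>v x = b}"
    using col_space_eq[OF M] M unfolding col_space_def by auto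
  have "rank M = nr \<longleftrightarrow> span (set (cols M)) = carrier_vec nr"
  proof
    assume r: "rank M = nr"
    \<comment> \<open>A maximal independent set of columns has \<open>rank M\<close> elements. If
      this number is \<open>nr\<close>, the dimension of the space, the set is already a
      basis.\<close>
    obtain S where S: "maximal S (\<lambda>T. T \<subseteq> set (cols M) \<and> lin_indpt T)" "finite S"
      using maximal_exists_superset[of "set (cols M)" "\<lambda>T. T \<subseteq> set (cols M) \<and> lin_indpt T" "{}"]
      by (auto simp: finite_lin_indpt2)
    have sub: "S \<subseteq> set (cols M)" and li: "lin_indpt S"
      using S(1) unfolding maximal_def by auto
    have "card S = nr"
      using rank_card_indpt[OF M S(1)] r by simp
    hence "basis S"
      using dim_li_is_basis[OF fin_dim S(2) _ li] sub cols by (auto simp: dim_is_n)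
    hence "span S = carrier_vec nr" unfolding basis_def by auto
    moreover have "span S \<subseteq> span (set (cols M))" using span_is_monotone[OF sub] .
    moreover have "span (set (cols M)) \<subseteq> carrier_vec nr" using span by auto
    ultimately show "span (set (cols M)) = carrier_vec nr" by auto
  next
    assume "span (set (cols M)) = carrier_vec nr"
    hence "vs (span (set (cols M))) = V" by (simp add: module_vec_def)
    thus "rank M = nr" unfolding rank_def by (simp add: dim_is_n)
  qed
  thus ?thesis unfolding full_row_rank_def using M span by auto
qed

text \<open>Gaussian elimination, by induction on the set of equations: each equation removes at
  most one unknown. Arbitrary finite index sets allow the later use with pairs of a time and a row
  or component.\<close>

lemma underdetermined_nonzero_solution:
  fixes a :: "'i \<Rightarrow> 'j \<Rightarrow> 'k :: field"
  assumes "finite I" "finite J" "card I < card J"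
  shows "\<exists>w. (\<exists>j\<in>J. w j \<noteq> 0) \<and> (\<forall>i\<in>I. (\<Sum>j\<in>J. a i j * w j) = 0)"
  using assms
proof (induction I arbitrary: J a rule: finite_induct)
  case empty
  then obtain j where "j \<in> J" by fastforce
  thus ?case by (intro exI[of _ "\<lambda>_. 1"]) auto
next
  case (insert k I)
  show ?case
  proof (cases "\<forall>j\<in>J. a k j = 0")
    case True
    have "card I < card J" using insert by simp
    from insert.IH[OF insert.prems(1) this, of a] obtain w
      where "\<exists>j\<in>J. w j \<noteq> 0" "\<forall>i\<in>I. (\<Sum>j\<in>J. a i j * w j) = 0" by blast
    with True show ?thesis by (intro exI[of _ w]) auto
  next
    case False
    then obtain q where q: "q \<in> J" "a k q \<noteq> 0" by blast
    let ?J = "J - {q}"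
    \<comment> \<open>Equation \<open>k\<close> is used as the pivot: \<open>?b\<close> holds the
      coefficients of the other equations after the unknown \<open>q\<close> has been
      eliminated.\<close>
    let ?b = "\<lambda>i j. a i j - a i q * a k j / a k q"
    have "card I < card ?J" using insert q by simp
    from insert.IH[OF _ this, of ?b] insert.prems(1) obtain w
      where w: "\<exists>j\<in>?J. w j \<noteq> 0" "\<forall>i\<in>I. (\<Sum>j\<in>?J. ?b i j * w j) = 0" by blast
    \<comment> \<open>Back substitution: \<open>c\<close> is the value of the unknown
      \<open>q\<close> that makes equation \<open>k\<close> hold.\<close>
    define c where "c = - (\<Sum>j\<in>?J. a k j * w j) / a k q"
    let ?w = "w(q := c)"
    have sum: "(\<Sum>j\<in>J. a i j * ?w j) = a i q * c + (\<Sum>j\<in>?J. a i j * w j)" for i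
      by (subst sum.remove[OF insert.prems(1) q(1)]) (auto intro!: sum.cong)
    have "(\<Sum>j\<in>J. a i j * ?w j) = 0" if i: "i \<in> insert k I" for i
    proof (cases "i = k")
      case True
      thus ?thesis unfolding sum unfolding c_def using q by simp
    next
      case False
      have "0 = (\<Sum>j\<in>?J. ?b i j * w j)" using w(2) i False by auto
      also have "\<dots> = (\<Sum>j\<in>?J. a i j * w j) - (\<Sum>j\<in>?J. a i q / a k q * (a k j * w j))"
        by (simp add: sum_subtractf[symmetric] algebra_simps)
      also have "(\<Sum>j\<in>?J. a i q / a k q * (a k j * w j)) = - a i q * c"
        unfolding c_def sum_distrib_left[symmetric] by simp
      finally show ?thesis unfolding sum by (simp add: add.commute)
    qed
    moreover have "\<exists>j\<in>J. ?w j \<noteq> 0" using w(1) by auto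
    ultimately show ?thesis by blast
  qed
qed

section \<open>Counting equations and unknowns in the closed loop\<close>

text \<open>A sequence supported on \<open>T\<close> consecutive times has \<open>T * d\<close> free
  entries, and only \<open>(T + 2) * s\<close> scalar equations see the support. As
  \<open>s < d\<close>, the unknowns win for large \<open>T\<close>.\<close>

lemma finitely_supported_homogeneous_solution:
  fixes M2 M1 M0 :: "int \<Rightarrow> 'a :: field mat"
  assumes M: "\<And>n. n \<ge> n0 \<Longrightarrow>
      M2 n \<in> carrier_mat s d \<and> M1 n \<in> carrier_mat s d \<and> M0 n \<in> carrier_mat s d"
    and sd: "s < d"
  shows "\<exists>z. (\<forall>n. z n \<in> carrier_vec d) \<and> z n0 = 0\<^sub>v d \<and> z (n0 + 1) = 0\<^sub>v d \<and>
      (\<exists>n\<ge>n0. z n \<noteq> 0\<^sub>v d) \<and>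
      (\<forall>n\<ge>n0. M2 n *\<^sub>v z (n + 2) + M1 n *\<^sub>v z (n + 1) + M0 n *\<^sub>v z n = 0\<^sub>v s)"
proof -
  \<comment> \<open>With \<open>s + 1 \<le> d\<close> it suffices that
    \<open>(T + 2) * s < T * (s + 1)\<close>, that is \<open>2 * s < T\<close>; this is the least
    such \<open>T\<close>.\<close>
  define T where "T = 2 * s + 1"
  \<comment> \<open>The support starts at \<open>n0 + 2\<close>, so both initial values vanish.
    Equation \<open>n\<close> involves the times \<open>n\<close> to \<open>n + 2\<close>, hence
    \<open>R\<close> is met exactly by the \<open>T + 2\<close> times from \<open>n0\<close> to
    \<open>n0 + 1 + T\<close> that occur in \<open>I\<close>.\<close>
  define R where "R = {n0 + 2..<n0 + 2 + int T}"
  define I where "I = {n0..<n0 + 2 + int T} \<times> {0..<s}"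
  define J where "J = R \<times> {0..<d}"
  \<comment> \<open>Coefficient of component \<open>j\<close> at time \<open>t\<close> in row
    \<open>i\<close> of equation \<open>n\<close>. At most one summand is nonzero; writing a sum
    lets \<open>pick\<close> treat the three matrices separately.\<close>
  define a where "a = (\<lambda>(n, i) (t, j). (if t = n + 2 then M2 n $$ (i, j) else 0) +
    (if t = n + 1 then M1 n $$ (i, j) else 0) + (if t = n then M0 n $$ (i, j) else 0))"
  have "(T + 2) * s < T * (s + 1)" unfolding T_def by (simp add: algebra_simps)
  also have "\<dots> \<le> T * d" using sd by (intro mult_le_mono) auto
  finally have "card I < card J" 
    unfolding I_def J_def R_def by (simp add: card_cartesian_product add.commute nat_add_distrib)
  moreover have fin: "finite I" "finite J" "finite R" unfolding I_def J_def R_def by auto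
  ultimately obtain w where w: "\<exists>j\<in>J. w j \<noteq> 0" "\<forall>i\<in>I. (\<Sum>j\<in>J. a i j * w j) = 0"
    using underdetermined_nonzero_solution[of I J a] by blast
  define z where "z = (\<lambda>t. vec d (\<lambda>j. if t \<in> R then w (t, j) else 0))"
  have zc: "z t \<in> carrier_vec d" for t unfolding z_def by simp
  have z0: "z t = 0\<^sub>v d" if "t \<notin> R" for t using that unfolding z_def by auto
  \<comment> \<open>This also covers \<open>k \<notin> R\<close>: the left side is then an empty
    selection, and \<open>z k\<close> is zero on the right.\<close>
  have pick: "(\<Sum>t\<in>R. \<Sum>j = 0..<d. (if t = k then N $$ (i, j) else 0) * w (t, j)) = (N *\<^sub>v z k) $ i"
    if N: "N \<in> carrier_mat s d" and i: "i < s" for N k i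
  proof -
    have "(\<Sum>t\<in>R. \<Sum>j = 0..<d. (if t = k then N $$ (i, j) else 0) * w (t, j)) =
        (\<Sum>t\<in>R. if t = k then \<Sum>j = 0..<d. N $$ (i, j) * w (k, j) else 0)"
      by (intro sum.cong) auto
    also have "\<dots> = (if k \<in> R then \<Sum>j = 0..<d. N $$ (i, j) * w (k, j) else 0)"
      using fin by simp
    also have "\<dots> = (N *\<^sub>v z k) $ i"
      using N i unfolding z_def by (auto simp: scalar_prod_def)
    finally show ?thesis .
  qed
  have "M2 n *\<^sub>v z (n + 2) + M1 n *\<^sub>v z (n + 1) + M0 n *\<^sub>v z n = 0\<^sub>v s" if n: "n \<ge> n0" for n
  proof (rule eq_vecI)
    fix i assume "i < dim_vec (0\<^sub>v s :: 'a vec)"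
    hence i: "i < s" by simp
    have Mn: "M2 n \<in> carrier_mat s d" "M1 n \<in> carrier_mat s d" "M0 n \<in> carrier_mat s d"
      using M n by auto
    have "(M2 n *\<^sub>v z (n + 2) + M1 n *\<^sub>v z (n + 1) + M0 n *\<^sub>v z n) $ i =
        (M2 n *\<^sub>v z (n + 2)) $ i + (M1 n *\<^sub>v z (n + 1)) $ i + (M0 n *\<^sub>v z n) $ i"
      using Mn i by simp
    also have "\<dots> = (\<Sum>t\<in>R. \<Sum>j = 0..<d. a (n, i) (t, j) * w (t, j))"
      unfolding pick[OF Mn(1) i, symmetric] pick[OF Mn(2) i, symmetric] pick[OF Mn(3) i, symmetric]
        a_def prod.case distrib_right sum.distrib ..
    also have "\<dots> = (\<Sum>j\<in>J. a (n, i) j * w j)"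
      unfolding J_def by (simp add: sum.cartesian_product case_prod_beta)
    also have "\<dots> = 0"
    proof (cases "n < n0 + 2 + int T")
      case True
      thus ?thesis using w(2) n i unfolding I_def by auto
    next
      \<comment> \<open>Here \<open>n\<close>, \<open>n + 1\<close> and \<open>n + 2\<close> all lie
        after the support, so every coefficient vanishes.\<close>
      case False
      thus ?thesis by (intro sum.neutral) (auto simp: a_def J_def R_def)
    qed
    finally show "(M2 n *\<^sub>v z (n + 2) + M1 n *\<^sub>v z (n + 1) + M0 n *\<^sub>v z n) $ i = 0\<^sub>v s $ i"
      using i by simp
  qed (use M n in auto)
  moreover obtain t j where tj: "t \<in> R" "j < d" "w (t, j) \<noteq> 0" using w(1) unfolding J_def by auto
  hence "z t $ j \<noteq> 0" unfolding z_def by simp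
  hence "z t \<noteq> 0\<^sub>v d" using tj(2) by auto
  moreover have "t \<ge> n0" using tj(1) unfolding R_def by simp
  moreover have "z n0 = 0\<^sub>v d" "z (n0 + 1) = 0\<^sub>v d" by (auto intro!: z0 simp: R_def)
  ultimately show ?thesis using zc by blast
qed

text \<open>Distributivity turns the closed loop into the open system driven by the input that
  \<open>x\<close> itself generates. This makes statements about a fixed input sequence applicable
  to the feedback.\<close>

lemma closed_loop_iff_descriptor_solution:
  assumes dims: "\<forall>n\<ge>n0. A n \<in> carrier_mat m d \<and> B n \<in> carrier_mat m d \<and> C n \<in> carrier_mat m d \<and>
      D n \<in> carrier_mat m p"
    and F: "\<forall>n\<ge>n0. F1 n \<in> carrier_mat p d \<and> F0 n \<in> carrier_mat p d"
  shows "closed_loop_ivp_solution n0 d A B C D f F1 F0 x0 x1 x \<longleftrightarrow>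
    descriptor_solution n0 d p A B C D f x (\<lambda>n. F1 n *\<^sub>v x (n + 1) + F0 n *\<^sub>v x n) \<and>
    x (n0 + 1) = x1 \<and> x n0 = x0"
proof -
  have eq: "A n *\<^sub>v x (n + 2) + (B n + D n * F1 n) *\<^sub>v x (n + 1) + (C n + D n * F0 n) *\<^sub>v x n =
      A n *\<^sub>v x (n + 2) + B n *\<^sub>v x (n + 1) + C n *\<^sub>v x n +
        D n *\<^sub>v (F1 n *\<^sub>v x (n + 1) + F0 n *\<^sub>v x n)"
    if n: "n \<ge> n0" and x: "\<forall>n\<ge>n0. x n \<in> carrier_vec d" for n
  proof -
    have M: "A n \<in> carrier_mat m d" "B n \<in> carrier_mat m d" "C n \<in> carrier_mat m d"
      "D n \<in> carrier_mat m p" "F1 n \<in> carrier_mat p d" "F0 n \<in> carrier_mat p d"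
      using dims F n by auto
    have X: "x (n + 1) \<in> carrier_vec d" "x n \<in> carrier_vec d" using x n by auto
    have FX: "F1 n *\<^sub>v x (n + 1) \<in> carrier_vec p" "F0 n *\<^sub>v x n \<in> carrier_vec p"
      using M X by auto
    have 1: "(B n + D n * F1 n) *\<^sub>v x (n + 1) = B n *\<^sub>v x (n + 1) + D n *\<^sub>v (F1 n *\<^sub>v x (n + 1))"
      using M X by (simp add: add_mult_distrib_mat_vec[of _ m d] assoc_mult_mat_vec[of _ m p _ d])
    have 2: "(C n + D n * F0 n) *\<^sub>v x n = C n *\<^sub>v x n + D n *\<^sub>v (F0 n *\<^sub>v x n)"
      using M X by (simp add: add_mult_distrib_mat_vec[of _ m d] assoc_mult_mat_vec[of _ m p _ d])
    show ?thesis
      unfolding 1 2 mult_add_distrib_mat_vec[OF M(4) FX]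
      by (rule eq_vecI) (use M in auto)
  qed
  \<comment> \<open>The dimension of a matrix-vector product is the number of rows of the matrix,
    whatever \<open>x\<close> is.\<close>
  have "F1 n *\<^sub>v x (n + 1) + F0 n *\<^sub>v x n \<in> carrier_vec p" if "n \<ge> n0" for n
    using F that by (intro add_carrier_vec mult_mat_vec_carrier[of _ p d] carrier_vecI) auto
  thus ?thesis
    unfolding closed_loop_ivp_solution_def descriptor_solution_def using eq by auto
qed

text \<open>With fewer than \<open>d\<close> rows the equivalent closed loop would have a nonzero
  homogeneous solution with zero initial values. Added to a solution, it gives a second one with the
  same initial values.\<close>

lemma uniquely_solvable_closed_loop_rows_ge:
  assumes dims: "\<forall>n\<ge>n0. A n \<in> carrier_mat m d \<and> B n \<in> carrier_mat m d \<and> C n \<in> carrier_mat m d \<and>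
      D n \<in> carrier_mat m p"
    and dims': "\<forall>n\<ge>n0. A' n \<in> carrier_mat s d \<and> B' n \<in> carrier_mat s d \<and> C' n \<in> carrier_mat s d \<and>
      D' n \<in> carrier_mat s p"
    and equiv: "\<And>x u. (\<forall>n\<ge>n0. u n \<in> carrier_vec p) \<Longrightarrow>
      descriptor_solution n0 d p A' B' C' D' f' x u \<longleftrightarrow> descriptor_solution n0 d p A B C D f x u"
    and F: "\<forall>n\<ge>n0. F1 n \<in> carrier_mat p d \<and> F0 n \<in> carrier_mat p d"
    and solvable: "closed_loop_uniquely_solvable n0 d A B C D f F1 F0"
  shows "d \<le> s"
proof (rule ccontr)
  assume "\<not> d \<le> s"
  hence sd: "s < d" by simp
  define M1 where "M1 = (\<lambda>n. B' n + D' n * F1 n)"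
  define M0 where "M0 = (\<lambda>n. C' n + D' n * F0 n)"
  have M: "A' n \<in> carrier_mat s d \<and> M1 n \<in> carrier_mat s d \<and> M0 n \<in> carrier_mat s d" if "n \<ge> n0" for n
    using dims' F that unfolding M1_def M0_def by auto
  obtain z where z: "\<forall>n. z n \<in> carrier_vec d" "z n0 = 0\<^sub>v d" "z (n0 + 1) = 0\<^sub>v d"
      "\<exists>n\<ge>n0. z n \<noteq> 0\<^sub>v d"
      "\<forall>n\<ge>n0. A' n *\<^sub>v z (n + 2) + M1 n *\<^sub>v z (n + 1) + M0 n *\<^sub>v z n = 0\<^sub>v s"
    using finitely_supported_homogeneous_solution[of n0 A' s d M1 M0] M sd by blast
  \<comment> \<open>Solution sets agree for each fixed input, in particular for the input generated
    by the given \<open>x\<close>; so the same feedback yields equivalent closed loops.\<close>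
  have closed_equiv: "closed_loop_ivp_solution n0 d A' B' C' D' f' F1 F0 x0 x1 x \<longleftrightarrow>
      closed_loop_ivp_solution n0 d A B C D f F1 F0 x0 x1 x" for x0 x1 x
  proof -
    have "\<forall>n\<ge>n0. F1 n *\<^sub>v x (n + 1) + F0 n *\<^sub>v x n \<in> carrier_vec p"
      using F by (intro allI impI carrier_vecI) auto
    from equiv[OF this, of x] show ?thesis
      unfolding closed_loop_iff_descriptor_solution[OF dims F]
        closed_loop_iff_descriptor_solution[OF dims' F] by simp
  qed
  obtain x0 x1 x where x: "closed_loop_ivp_solution n0 d A B C D f F1 F0 x0 x1 x"
    and unique: "\<And>y. closed_loop_ivp_solution n0 d A B C D f F1 F0 x0 x1 y \<Longrightarrow> \<forall>n\<ge>n0. y n = x n"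
    using solvable unfolding closed_loop_uniquely_solvable_def by blast
  have x': "closed_loop_ivp_solution n0 d A' B' C' D' f' F1 F0 x0 x1 x"
    using x closed_equiv by blast
  hence xc: "x n \<in> carrier_vec d" if "n \<ge> n0" for n
    using that unfolding closed_loop_ivp_solution_def by auto
  define y where "y = (\<lambda>n. x n + z n)"
  have "A' n *\<^sub>v y (n + 2) + M1 n *\<^sub>v y (n + 1) + M0 n *\<^sub>v y n = f' n" if n: "n \<ge> n0" for n
  proof -
    have X: "x (n + 2) \<in> carrier_vec d" "x (n + 1) \<in> carrier_vec d" "x n \<in> carrier_vec d"
      using xc n by auto
    have Mn: "A' n \<in> carrier_mat s d" "M1 n \<in> carrier_mat s d" "M0 n \<in> carrier_mat s d"
      using M[OF n] by auto
    have f': "f' n = A' n *\<^sub>v x (n + 2) + M1 n *\<^sub>v x (n + 1) + M0 n *\<^sub>v x n"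
      using x' n unfolding closed_loop_ivp_solution_def M1_def M0_def by simp
    have "A' n *\<^sub>v y (n + 2) + M1 n *\<^sub>v y (n + 1) + M0 n *\<^sub>v y n =
        f' n + (A' n *\<^sub>v z (n + 2) + M1 n *\<^sub>v z (n + 1) + M0 n *\<^sub>v z n)"
      unfolding f' y_def
        mult_add_distrib_mat_vec[OF Mn(1) X(1) z(1)[rule_format]]
        mult_add_distrib_mat_vec[OF Mn(2) X(2) z(1)[rule_format]]
        mult_add_distrib_mat_vec[OF Mn(3) X(3) z(1)[rule_format]]
      by (rule eq_vecI) (use Mn in auto)
    also have "\<dots> = f' n + 0\<^sub>v s" using z(5) n by simp
    also have "\<dots> = f' n" unfolding f' by (rule eq_vecI) (use Mn in auto)
    finally show ?thesis .
  qed
  moreover have "y n \<in> carrier_vec d" if "n \<ge> n0" for n using xc[OF that] z(1) unfolding y_def by auto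
  moreover have "y n0 = x0" "y (n0 + 1) = x1"
    using x z(2,3) xc[of n0] xc[of "n0 + 1"] unfolding y_def closed_loop_ivp_solution_def by auto
  ultimately have "closed_loop_ivp_solution n0 d A' B' C' D' f' F1 F0 x0 x1 y"
    unfolding closed_loop_ivp_solution_def M1_def M0_def by blast
  hence yx: "y n = x n" if "n \<ge> n0" for n using unique closed_equiv that by blast
  obtain n where n: "n \<ge> n0" "z n \<noteq> 0\<^sub>v d" using z(4) by blast
  have "z n = 0\<^sub>v d"
  proof (rule eq_vecI)
    fix i assume i: "i < dim_vec (0\<^sub>v d :: real vec)"
    have "(x n + z n) $ i = x n $ i" using yx[OF n(1)] unfolding y_def by simp
    thus "z n $ i = 0\<^sub>v d $ i" 
      using i carrier_vecD[OF z(1)[rule_format, of n]] carrier_vecD[OF xc[OF n(1)]] by simp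
  qed (use z(1) in auto)
  with n(2) show False by blast
qed

section \<open>Block form and zero padding\<close>

text \<open>Separates the stacked equation into its five block equations; applied both to the
  extracted system and to its truncation.\<close>

lemma block_step:
  assumes H: "block_system_dims n0 d p H" and n: "n \<ge> n0"
    and X: "x2 \<in> carrier_vec d" "x1 \<in> carrier_vec d" "x0 \<in> carrier_vec d" "u \<in> carrier_vec p"
  shows "block_A d H n *\<^sub>v x2 + block_B d H n *\<^sub>v x1 + block_C H n *\<^sub>v x0 + block_D p H n *\<^sub>v u =
    (hA1 H n *\<^sub>v x2 + hB1 H n *\<^sub>v x1 + hC1 H n *\<^sub>v x0 + hD1 H n *\<^sub>v u) @\<^sub>v
    (hB2 H n *\<^sub>v x1 + hC2 H n *\<^sub>v x0) @\<^sub>v hC3 H n *\<^sub>v x0 @\<^sub>v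
    (hB5 H n *\<^sub>v x1 + hC5 H n *\<^sub>v x0 + hD4 H n *\<^sub>v u) @\<^sub>v
    (hC6 H n *\<^sub>v x0 + hD5 H n *\<^sub>v u)"
proof -
  have dims: "hA1 H n \<in> carrier_mat (hr2 H) d" "hB1 H n \<in> carrier_mat (hr2 H) d"
     "hC1 H n \<in> carrier_mat (hr2 H) d" "hD1 H n \<in> carrier_mat (hr2 H) p"
     "hB2 H n \<in> carrier_mat (hr1 H) d" "hC2 H n \<in> carrier_mat (hr1 H) d"
     "hC3 H n \<in> carrier_mat (hr0 H) d"
     "hB5 H n \<in> carrier_mat (hphi1 H) d" "hC5 H n \<in> carrier_mat (hphi1 H) d"
     "hD4 H n \<in> carrier_mat (hphi1 H) p"
     "hC6 H n \<in> carrier_mat (hphi0 H) d" "hD5 H n \<in> carrier_mat (hphi0 H) p"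
    using H n unfolding block_system_dims_def by auto
  have zero: "0\<^sub>m k d *\<^sub>v y = 0\<^sub>v k" if "y \<in> carrier_vec d" for k and y :: "real vec"
    using that by (intro eq_vecI) auto
  have zero': "0\<^sub>m k p *\<^sub>v y = 0\<^sub>v k" if "y \<in> carrier_vec p" for k and y :: "real vec"
    using that by (intro eq_vecI) auto
  \<comment> \<open>Row appending associates to the right, so each splitting is given the total row
    number of the remaining blocks explicitly.\<close>
  have A: "block_A d H n *\<^sub>v x2 = hA1 H n *\<^sub>v x2 @\<^sub>v 0\<^sub>v (hr1 H) @\<^sub>v 0\<^sub>v (hr0 H) @\<^sub>v
      0\<^sub>v (hphi1 H) @\<^sub>v 0\<^sub>v (hphi0 H)"
    unfolding block_A_def using X dims
    by (simp add: mat_mult_append[of _ "hr2 H" d _ "hr1 H + (hr0 H + (hphi1 H + hphi0 H))"]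
      mat_mult_append[of _ "hr1 H" d _ "hr0 H + (hphi1 H + hphi0 H)"]
      mat_mult_append[of _ "hr0 H" d _ "hphi1 H + hphi0 H"]
      mat_mult_append[of _ "hphi1 H" d _ "hphi0 H"] zero)
  have B: "block_B d H n *\<^sub>v x1 = hB1 H n *\<^sub>v x1 @\<^sub>v hB2 H n *\<^sub>v x1 @\<^sub>v 0\<^sub>v (hr0 H) @\<^sub>v
      hB5 H n *\<^sub>v x1 @\<^sub>v 0\<^sub>v (hphi0 H)"
    unfolding block_B_def using X dims
    by (simp add: mat_mult_append[of _ "hr2 H" d _ "hr1 H + (hr0 H + (hphi1 H + hphi0 H))"]
      mat_mult_append[of _ "hr1 H" d _ "hr0 H + (hphi1 H + hphi0 H)"]
      mat_mult_append[of _ "hr0 H" d _ "hphi1 H + hphi0 H"]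
      mat_mult_append[of _ "hphi1 H" d _ "hphi0 H"] zero)
  have C: "block_C H n *\<^sub>v x0 = hC1 H n *\<^sub>v x0 @\<^sub>v hC2 H n *\<^sub>v x0 @\<^sub>v hC3 H n *\<^sub>v x0 @\<^sub>v
      hC5 H n *\<^sub>v x0 @\<^sub>v hC6 H n *\<^sub>v x0"
    unfolding block_C_def using X dims
    by (simp add: mat_mult_append[of _ "hr2 H" d _ "hr1 H + (hr0 H + (hphi1 H + hphi0 H))"]
      mat_mult_append[of _ "hr1 H" d _ "hr0 H + (hphi1 H + hphi0 H)"]
      mat_mult_append[of _ "hr0 H" d _ "hphi1 H + hphi0 H"]
      mat_mult_append[of _ "hphi1 H" d _ "hphi0 H"] zero)
  have D: "block_D p H n *\<^sub>v u = hD1 H n *\<^sub>v u @\<^sub>v 0\<^sub>v (hr1 H) @\<^sub>v 0\<^sub>v (hr0 H) @\<^sub>v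
      hD4 H n *\<^sub>v u @\<^sub>v hD5 H n *\<^sub>v u"
    unfolding block_D_def using X dims
    by (simp add: mat_mult_append[of _ "hr2 H" p _ "hr1 H + (hr0 H + (hphi1 H + hphi0 H))"]
      mat_mult_append[of _ "hr1 H" p _ "hr0 H + (hphi1 H + hphi0 H)"]
      mat_mult_append[of _ "hr0 H" p _ "hphi1 H + hphi0 H"]
      mat_mult_append[of _ "hphi1 H" p _ "hphi0 H"] zero')
  show ?thesis unfolding A B C D
    using X dims
    by (simp add: append_vec_add[of _ "hr2 H" _ _ "hr1 H + (hr0 H + (hphi1 H + hphi0 H))"]
      append_vec_add[of _ "hr1 H" _ _ "hr0 H + (hphi1 H + hphi0 H)"]
      append_vec_add[of _ "hr0 H" _ _ "hphi1 H + hphi0 H"]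
      append_vec_add[of _ "hphi1 H" _ _ "hphi0 H"])
qed

text \<open>The \<open>v\<close> zero rows constrain only the right-hand side, independently of
  \<open>x\<close> and \<open>u\<close>. One existing solution therefore settles that condition for
  all of them.\<close>

lemma padded_descriptor_solution_iff:
  assumes dims: "\<forall>n\<ge>n0. A n \<in> carrier_mat s d \<and> B n \<in> carrier_mat s d \<and> C n \<in> carrier_mat s d \<and>
      D n \<in> carrier_mat s p"
  shows "descriptor_solution n0 d p (\<lambda>n. A n @\<^sub>r 0\<^sub>m v d) (\<lambda>n. B n @\<^sub>r 0\<^sub>m v d)
      (\<lambda>n. C n @\<^sub>r 0\<^sub>m v d) (\<lambda>n. D n @\<^sub>r 0\<^sub>m v p) f x u \<longleftrightarrow>
    descriptor_solution n0 d p A B C D (\<lambda>n. vec_first (f n) s) x u \<and>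
    (\<forall>n\<ge>n0. f n = vec_first (f n) s @\<^sub>v 0\<^sub>v v)"
proof -
  have zero: "0\<^sub>m v k *\<^sub>v y = 0\<^sub>v v" if "y \<in> carrier_vec k" for k and y :: "real vec"
    using that by (intro eq_vecI) auto
  have first: "vec_first (a @\<^sub>v b) s = a" if "a \<in> carrier_vec s" for a b :: "real vec"
    using that by (intro eq_vecI) (auto simp: vec_first_def)
  have "(A n @\<^sub>r 0\<^sub>m v d) *\<^sub>v x (n + 2) + (B n @\<^sub>r 0\<^sub>m v d) *\<^sub>v x (n + 1) +
      (C n @\<^sub>r 0\<^sub>m v d) *\<^sub>v x n + (D n @\<^sub>r 0\<^sub>m v p) *\<^sub>v u n = f n \<longleftrightarrow>
    A n *\<^sub>v x (n + 2) + B n *\<^sub>v x (n + 1) + C n *\<^sub>v x n + D n *\<^sub>v u n = vec_first (f n) s \<and>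
      f n = vec_first (f n) s @\<^sub>v 0\<^sub>v v"
    if n: "n \<ge> n0" and x: "\<forall>n\<ge>n0. x n \<in> carrier_vec d" and u: "u n \<in> carrier_vec p" for n
  proof -
    let ?L = "A n *\<^sub>v x (n + 2) + B n *\<^sub>v x (n + 1) + C n *\<^sub>v x n + D n *\<^sub>v u n"
    have M: "A n \<in> carrier_mat s d" "B n \<in> carrier_mat s d" "C n \<in> carrier_mat s d"
      "D n \<in> carrier_mat s p" using dims n by auto
    have X: "x (n + 2) \<in> carrier_vec d" "x (n + 1) \<in> carrier_vec d" "x n \<in> carrier_vec d"
      using x n by auto
    have L: "?L \<in> carrier_vec s" using M X u by auto
    have "(A n @\<^sub>r 0\<^sub>m v d) *\<^sub>v x (n + 2) + (B n @\<^sub>r 0\<^sub>m v d) *\<^sub>v x (n + 1) +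
      (C n @\<^sub>r 0\<^sub>m v d) *\<^sub>v x n + (D n @\<^sub>r 0\<^sub>m v p) *\<^sub>v u n = ?L @\<^sub>v 0\<^sub>v v"
      using M X u
      by (simp add: mat_mult_append[of _ s _ _ v] append_vec_add[of _ s _ _ v] zero)
    thus ?thesis using first[OF L] by metis
  qed
  thus ?thesis unfolding descriptor_solution_def by blast
qed

section \<open>Dropping rows\<close>

text \<open>Meant for \<open>k\<close> at most the number of rows of \<open>M\<close>; for larger
  \<open>k\<close> the additional entries are read outside \<open>M\<close>.\<close>

definition top_rows :: "nat \<Rightarrow> 'a mat \<Rightarrow> 'a mat" where
  "top_rows k M = mat k (dim_col M) (\<lambda>(i, j). M $$ (i, j))"

lemma top_rows_carrier [simp, intro]: "M \<in> carrier_mat nr nc \<Longrightarrow> top_rows k M \<in> carrier_mat k nc"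
  unfolding top_rows_def by auto

lemma top_rows_mult_vec:
  assumes "M \<in> carrier_mat nr nc" "k \<le> nr" "x \<in> carrier_vec nc"
  shows "top_rows k M *\<^sub>v x = vec_first (M *\<^sub>v x) k"
  using assms by (intro eq_vecI) (auto simp: top_rows_def vec_first_def scalar_prod_def)

text \<open>By surjectivity: extend the target arbitrarily to the dropped rows, solve the full
  system, and forget those rows.\<close>

lemma full_row_rank_top_rows:
  assumes M: "M \<in> carrier_mat r nc" and N: "N \<in> carrier_mat s nc"
    and k: "k \<le> r" and l: "l \<le> s" and full: "full_row_rank (M @\<^sub>r N)"
  shows "full_row_rank (top_rows k M @\<^sub>r top_rows l N)"
proof (rule full_row_rank_iff_surj[THEN iffD2])
  show "top_rows k M @\<^sub>r top_rows l N \<in> carrier_mat (k + l) nc" using M N by auto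
  show "\<forall>b\<in>carrier_vec (k + l). \<exists>x\<in>carrier_vec nc. (top_rows k M @\<^sub>r top_rows l N) *\<^sub>v x = b"
  proof
    fix b :: "real vec" assume b: "b \<in> carrier_vec (k + l)"
    \<comment> \<open>The entries of \<open>b1\<close> from \<open>k\<close> on and of
      \<open>b2\<close> from \<open>l\<close> on are arbitrary filler, cut off again by
      \<open>vec_first\<close>.\<close>
    define b1 where "b1 = vec r (\<lambda>i. b $ i)"
    define b2 where "b2 = vec s (\<lambda>i. b $ (k + i))"
    have bc: "b1 \<in> carrier_vec r" "b2 \<in> carrier_vec s" unfolding b1_def b2_def by auto
    obtain x where x: "x \<in> carrier_vec nc" "(M @\<^sub>r N) *\<^sub>v x = b1 @\<^sub>v b2"
      using full full_row_rank_iff_surj[OF carrier_append_rows[OF M N]] bc by auto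
    have "M *\<^sub>v x = b1" "N *\<^sub>v x = b2"
      using x mat_mult_append[OF M N x(1)] append_vec_eq[of "M *\<^sub>v x" r b1] bc M by auto
    hence "(top_rows k M @\<^sub>r top_rows l N) *\<^sub>v x = vec_first b1 k @\<^sub>v vec_first b2 l"
      using mat_mult_append[OF top_rows_carrier[OF M] top_rows_carrier[OF N] x(1)]
        top_rows_mult_vec[OF M k x(1)] top_rows_mult_vec[OF N l x(1)] by simp
    also have "\<dots> = b"
      using b k l by (intro eq_vecI) (auto simp: vec_first_def b1_def b2_def)
    finally show "\<exists>x\<in>carrier_vec nc. (top_rows k M @\<^sub>r top_rows l N) *\<^sub>v x = b" using x by blast
  qed
qed

section \<open>Truncating the extracted system to exactly \<open>d\<close> rows\<close>

theorem theorem5p6: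
  fixes n0 :: int and m d p \<nu> :: nat
    and A B C D :: "int \<Rightarrow> real mat" and f :: "int \<Rightarrow> real vec"
  assumes "\<forall>n\<ge>n0. A n \<in> carrier_mat m d \<and> B n \<in> carrier_mat m d \<and> C n \<in> carrier_mat m d \<and>
             D n \<in> carrier_mat m p \<and> f n \<in> carrier_vec m"
    and "has_shift_index n0 m d p A B C D f \<nu>"
    and "\<exists>F1 F0. (\<forall>n\<ge>n0. F1 n \<in> carrier_mat p d \<and> F0 n \<in> carrier_mat p d) \<and>
           closed_loop_uniquely_solvable n0 d A B C D f F1 F0"
  shows "\<exists>H G1 G2 G3 G4 G5.
    block_system_dims n0 d p H \<and>
    (\<forall>n\<ge>n0. G1 n \<in> carrier_vec (hr2 H) \<and> G2 n \<in> carrier_vec (hr1 H) \<and>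
       G3 n \<in> carrier_vec (hr0 H) \<and> G4 n \<in> carrier_vec (hphi1 H) \<and>
       G5 n \<in> carrier_vec (hphi0 H)) \<and>
    (\<forall>x u. descriptor_solution n0 d p A B C D f x u \<longrightarrow>
       descriptor_solution n0 d p (block_A d H) (block_B d H) (block_C H) (block_D p H)
         (\<lambda>n. G1 n @\<^sub>v G2 n @\<^sub>v G3 n @\<^sub>v G4 n @\<^sub>v G5 n) x u) \<and>
    (\<forall>n\<ge>n0. full_row_rank (state_rank_matrix H n) \<and> full_row_rank (input_rank_matrix H n)) \<and>
    hr2 H + hr1 H + hr0 H + hphi1 H + hphi0 H = d \<and>
    (\<forall>n\<ge>n0. vec_space.rank (hr2 H + hr1 H + hr0 H) (state_rank_matrix H n) +
             vec_space.rank (hphi1 H + hphi0 H) (input_rank_matrix H n) = d)"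
proof -
  have orig: "\<forall>n\<ge>n0. A n \<in> carrier_mat m d \<and> B n \<in> carrier_mat m d \<and> C n \<in> carrier_mat m d \<and>
      D n \<in> carrier_mat m p" using assms(1) by blast
  obtain F1 F0 where F: "\<forall>n\<ge>n0. F1 n \<in> carrier_mat p d \<and> F0 n \<in> carrier_mat p d"
    and solvable: "closed_loop_uniquely_solvable n0 d A B C D f F1 F0" using assms(3) by blast
  obtain l where "strangeness_free_extractable n0 m d p A B C D f l"
    using assms(2) unfolding has_shift_index_def by blast
  then obtain H v hf where H: "block_system_dims n0 d p H"
    and full: "block_system_full_rank n0 H"
    and equiv: "\<forall>u. (\<forall>n\<ge>n0. u n \<in> carrier_vec p) \<longrightarrow>
        {x. descriptor_solution n0 d p (\<lambda>n. block_A d H n @\<^sub>r 0\<^sub>m v d) (\<lambda>n. block_B d H n @\<^sub>r 0\<^sub>m v d)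
          (\<lambda>n. block_C H n @\<^sub>r 0\<^sub>m v d) (\<lambda>n. block_D p H n @\<^sub>r 0\<^sub>m v p) hf x u} =
        {x. descriptor_solution n0 d p A B C D f x u}"
    unfolding strangeness_free_extractable_def Let_def by blast
  define s where "s = block_rows H"
  define g where "g = (\<lambda>n. vec_first (hf n) s)"
  have s: "s = hr2 H + (hr1 H + (hr0 H + (hphi1 H + hphi0 H)))"
    unfolding s_def block_rows_def by simp
  have block: "\<forall>n\<ge>n0. block_A d H n \<in> carrier_mat s d \<and> block_B d H n \<in> carrier_mat s d \<and>
      block_C H n \<in> carrier_mat s d \<and> block_D p H n \<in> carrier_mat s p"
    using H unfolding s block_system_dims_def block_A_def block_B_def block_C_def block_D_def
    by (intro allI impI conjI carrier_append_rows) auto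
  have padded: "descriptor_solution n0 d p A B C D f x u \<longleftrightarrow>
      descriptor_solution n0 d p (block_A d H) (block_B d H) (block_C H) (block_D p H) g x u \<and>
      (\<forall>n\<ge>n0. hf n = g n @\<^sub>v 0\<^sub>v v)" if "\<forall>n\<ge>n0. u n \<in> carrier_vec p" for x u
    using equiv[rule_format, of u] that
      padded_descriptor_solution_iff[OF block, of v hf x u] unfolding g_def by blast
  have solution_inputs: "\<forall>n\<ge>n0. u n \<in> carrier_vec p"
    if "descriptor_solution n0 d p A B C D f x u" for x u
    using that unfolding descriptor_solution_def by blast
  \<comment> \<open>Consistent initial values exist, so there is an actual solution. It forces the
    last \<open>v\<close> entries of \<open>hf\<close> to vanish, after which the padding can be
    removed for every input.\<close>
  obtain x where x: "descriptor_solution n0 d p A B C D f x (\<lambda>n. F1 n *\<^sub>v x (n + 1) + F0 n *\<^sub>v x n)"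
    using solvable closed_loop_iff_descriptor_solution[OF orig F]
    unfolding closed_loop_uniquely_solvable_def consistent_initial_values_def by blast
  have "\<forall>n\<ge>n0. hf n = g n @\<^sub>v 0\<^sub>v v"
    using padded[OF solution_inputs[OF x], of x] x by blast
  hence equiv': "descriptor_solution n0 d p (block_A d H) (block_B d H) (block_C H) (block_D p H) g x u
      \<longleftrightarrow> descriptor_solution n0 d p A B C D f x u" if "\<forall>n\<ge>n0. u n \<in> carrier_vec p" for x u
    using padded[OF that] by blast
  have ds: "d \<le> s"
    by (rule uniquely_solvable_closed_loop_rows_ge[OF orig block equiv' F solvable])
  have state: "state_rank_matrix H n \<in> carrier_mat (hr2 H + hr1 H + hr0 H) d" if "n \<ge> n0" for n
    using H that unfolding block_system_dims_def state_rank_matrix_def add.assoc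
    by (intro carrier_append_rows) auto
  \<comment> \<open>The state rows are independent in a space of dimension \<open>d\<close>. The
    time \<open>n0\<close> suffices because the block sizes are constant.\<close>
  have "hr2 H + hr1 H + hr0 H \<le> d"
    using full state[of n0] vec_space.rank_le_nc[OF state[of n0]]
    unfolding block_system_full_rank_def full_row_rank_def by auto
  then obtain k1 k0 where k: "k1 \<le> hphi1 H" "k0 \<le> hphi0 H" "hr2 H + hr1 H + hr0 H + k1 + k0 = d"
  proof -
    assume r: "hr2 H + hr1 H + hr0 H \<le> d"
    \<comment> \<open>The \<open>e\<close> missing rows are taken from the block of size
      \<open>hphi1 H\<close> as far as it reaches and then from the one of size
      \<open>hphi0 H\<close>; \<open>d \<le> s\<close> guarantees enough of them.\<close>
    define e where "e = d - (hr2 H + hr1 H + hr0 H)"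
    have "min e (hphi1 H) \<le> hphi1 H" "e - min e (hphi1 H) \<le> hphi0 H"
      "hr2 H + hr1 H + hr0 H + min e (hphi1 H) + (e - min e (hphi1 H)) = d"
      using r ds s unfolding e_def by auto
    thus ?thesis using that by blast
  qed
  \<comment> \<open>Only the two blocks behind \<open>input_rank_matrix\<close> are cut, so the
    state rank matrix is unchanged.\<close>
  define K where "K = H\<lparr>hphi1 := k1, hphi0 := k0,
    hB5 := \<lambda>n. top_rows k1 (hB5 H n), hC5 := \<lambda>n. top_rows k1 (hC5 H n),
    hD4 := \<lambda>n. top_rows k1 (hD4 H n),
    hC6 := \<lambda>n. top_rows k0 (hC6 H n), hD5 := \<lambda>n. top_rows k0 (hD5 H n)\<rparr>"
  have K: "block_system_dims n0 d p K"
    using H unfolding block_system_dims_def K_def by auto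
  have stateK: "state_rank_matrix K = state_rank_matrix H"
    unfolding state_rank_matrix_def K_def by auto
  have inputK: "input_rank_matrix K n \<in> carrier_mat (k1 + k0) p" if "n \<ge> n0" for n
    using K that unfolding block_system_dims_def input_rank_matrix_def
    by (intro carrier_append_rows) (auto simp: K_def)
  have fullK: "full_row_rank (state_rank_matrix K n)" "full_row_rank (input_rank_matrix K n)"
    if n: "n \<ge> n0" for n
  proof -
    show "full_row_rank (state_rank_matrix K n)"
      unfolding stateK using full n unfolding block_system_full_rank_def by blast
    have "hD4 H n \<in> carrier_mat (hphi1 H) p" "hD5 H n \<in> carrier_mat (hphi0 H) p"
      using H n unfolding block_system_dims_def by auto
    from full_row_rank_top_rows[OF this k(1,2)]
    show "full_row_rank (input_rank_matrix K n)"
      using full n unfolding block_system_full_rank_def input_rank_matrix_def K_def by simp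
  qed
  define slice where "slice = (\<lambda>a k n. vec k (\<lambda>i. g n $ (a + i)))"
  define G1 where "G1 = slice 0 (hr2 H)"
  define G2 where "G2 = slice (hr2 H) (hr1 H)"
  define G3 where "G3 = slice (hr2 H + hr1 H) (hr0 H)"
  define G4 where "G4 = slice (hr2 H + hr1 H + hr0 H) k1"
  \<comment> \<open>The offset contains \<open>hphi1 H\<close> and not \<open>k1\<close>, since
    \<open>g\<close> still carries the entries of the dropped rows.\<close>
  define G5 where "G5 = slice (hr2 H + hr1 H + hr0 H + hphi1 H) k0"
  have "descriptor_solution n0 d p (block_A d K) (block_B d K) (block_C K) (block_D p K)
      (\<lambda>n. G1 n @\<^sub>v G2 n @\<^sub>v G3 n @\<^sub>v G4 n @\<^sub>v G5 n) x u"
    if sol: "descriptor_solution n0 d p A B C D f x u" for x u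
  proof -
    have sol': "descriptor_solution n0 d p (block_A d H) (block_B d H) (block_C H) (block_D p H) g x u"
      using equiv'[OF solution_inputs[OF sol]] sol by blast
    have "block_A d K n *\<^sub>v x (n + 2) + block_B d K n *\<^sub>v x (n + 1) + block_C K n *\<^sub>v x n +
        block_D p K n *\<^sub>v u n = G1 n @\<^sub>v G2 n @\<^sub>v G3 n @\<^sub>v G4 n @\<^sub>v G5 n" if n: "n \<ge> n0" for n
    proof -
      have X: "x (n + 2) \<in> carrier_vec d" "x (n + 1) \<in> carrier_vec d" "x n \<in> carrier_vec d"
        "u n \<in> carrier_vec p" using sol n unfolding descriptor_solution_def by auto
      define y1 where "y1 = hA1 H n *\<^sub>v x (n + 2) + hB1 H n *\<^sub>v x (n + 1) + hC1 H n *\<^sub>v x n + hD1 H n *\<^sub>v u n"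
      define y2 where "y2 = hB2 H n *\<^sub>v x (n + 1) + hC2 H n *\<^sub>v x n"
      define y3 where "y3 = hC3 H n *\<^sub>v x n"
      define y4 where "y4 = hB5 H n *\<^sub>v x (n + 1) + hC5 H n *\<^sub>v x n + hD4 H n *\<^sub>v u n"
      define y5 where "y5 = hC6 H n *\<^sub>v x n + hD5 H n *\<^sub>v u n"
      have g: "g n = y1 @\<^sub>v y2 @\<^sub>v y3 @\<^sub>v y4 @\<^sub>v y5"
        using sol' n block_step[OF H n X]
        unfolding descriptor_solution_def y1_def y2_def y3_def y4_def y5_def by metis
      have dims: "hB5 H n \<in> carrier_mat (hphi1 H) d" "hC5 H n \<in> carrier_mat (hphi1 H) d"
        "hD4 H n \<in> carrier_mat (hphi1 H) p"
        "hC6 H n \<in> carrier_mat (hphi0 H) d" "hD5 H n \<in> carrier_mat (hphi0 H) p"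
        using H n unfolding block_system_dims_def by auto
      have y: "dim_vec y1 = hr2 H" "dim_vec y2 = hr1 H" "dim_vec y3 = hr0 H"
        "dim_vec y4 = hphi1 H" "dim_vec y5 = hphi0 H"
        using H n unfolding block_system_dims_def y1_def y2_def y3_def y4_def y5_def by auto
      \<comment> \<open>Taking the first rows commutes with products and sums, so the retained
        equations are entries of the original ones.\<close>
      have "hB5 K n *\<^sub>v x (n + 1) + hC5 K n *\<^sub>v x n + hD4 K n *\<^sub>v u n = vec_first y4 k1"
        using dims X k(1) unfolding K_def y4_def
        by (intro eq_vecI) (auto simp: top_rows_mult_vec vec_first_def)
      moreover have "hC6 K n *\<^sub>v x n + hD5 K n *\<^sub>v u n = vec_first y5 k0"
        using dims X k(2) unfolding K_def y5_def
        by (intro eq_vecI) (auto simp: top_rows_mult_vec vec_first_def)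
      moreover have "hA1 K n *\<^sub>v x (n + 2) + hB1 K n *\<^sub>v x (n + 1) + hC1 K n *\<^sub>v x n + hD1 K n *\<^sub>v u n = y1"
        "hB2 K n *\<^sub>v x (n + 1) + hC2 K n *\<^sub>v x n = y2" "hC3 K n *\<^sub>v x n = y3"
        unfolding K_def y1_def y2_def y3_def by simp_all
      moreover have "y1 = G1 n" "y2 = G2 n" "y3 = G3 n" "vec_first y4 k1 = G4 n" "vec_first y5 k0 = G5 n"
        unfolding G1_def G2_def G3_def G4_def G5_def slice_def g vec_first_def
        using y k(1,2) by (auto intro!: eq_vecI)
      ultimately show ?thesis unfolding block_step[OF K n X] by simp
    qed
    thus ?thesis using sol unfolding descriptor_solution_def by simp
  qed
  \<comment> \<open>Full row rank makes each rank equal to the row number of its matrix. The block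
    of size \<open>hr1\<close> enters one step later and that of size \<open>hr0\<close> two steps
    later, but these sizes do not depend on time.\<close>
  moreover have "vec_space.rank (hr2 K + hr1 K + hr0 K) (state_rank_matrix K n) +
      vec_space.rank (hphi1 K + hphi0 K) (input_rank_matrix K n) = d" if n: "n \<ge> n0" for n
    using fullK[OF n] state[OF n] inputK[OF n] k(3)
    unfolding full_row_rank_def stateK by (simp add: K_def)
  moreover have "hr2 K + hr1 K + hr0 K + hphi1 K + hphi0 K = d"
    using k(3) unfolding K_def by simp
  moreover have "\<forall>n\<ge>n0. G1 n \<in> carrier_vec (hr2 K) \<and> G2 n \<in> carrier_vec (hr1 K) \<and>
      G3 n \<in> carrier_vec (hr0 K) \<and> G4 n \<in> carrier_vec (hphi1 K) \<and> G5 n \<in> carrier_vec (hphi0 K)"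
    unfolding G1_def G2_def G3_def G4_def G5_def slice_def K_def by simp
  ultimately show ?thesis using K fullK by blast
qed

end
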